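(* Let $n\ge1$ and let $q:\mathbb{R}^n_x\times\mathbb{R}^n_\xi\to\mathbb{C}$ be a complex-valued quadratic form with $\operatorname{Re}q\le0$ on $\mathbb{R}^{2n}$, which is elliptic on its singular space $S$, i.e. $(x,\xi)\in S$ and $q(x,\xi)=0$ imply $(x,\xi)=0$. Let $F$ be the Hamilton map of $q$. Then the set of real eigenvalues of $F$ can be written as $$\sigma(F)\cap\mathbb{R}=\{\lambda_1,\dots,\lambda_r,-\lambda_1,\dots,-\lambda_r\},$$ with $\lambda_j\neq0$ for all $j$ and $\lambda_j\neq\pm\lambda_k$ if $j\neq k$; each of the spaces $$S_{\lambda_j}=\big(\operatorname{Ker}(F-\lambda_j)\oplus\operatorname{Ker}(F+\lambda_j)\big)\cap\mathbb{R}^{2n},\qquad j=1,\dots,r,$$ is symplectic (the restriction of $\sigma$ to it is nondegenerate); and the singular space is the direct sum of these spaces, which are pairwise symplectically orthogonal: $$S=S_{\lambda_1}\oplus^{\sigma\perp}S_{\lambda_2}\oplus^{\sigma\perp}\cdots\oplus^{\sigma\perp}S_{\lambda_r}.$$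
   Context: The canonical symplectic form on $\mathbb{R}^{2n}$ is $\sigma((x,\xi),(y,\eta))=\xi\cdot y-x\cdot\eta$. The Hamilton map of $q$ is the matrix $F\in M_{2n}(\mathbb{C})$ uniquely defined by $q(X;Y)=\sigma(X,FY)$ for $X,Y\in\mathbb{R}^{2n}$, where $q(\cdot;\cdot)$ is the symmetric bilinear (polarized) form of $q$; $\sigma(F)$ is its set of eigenvalues, and the kernels $\operatorname{Ker}(F\pm\lambda)$ are taken in $\mathbb{C}^{2n}$. $\operatorname{Re}F$ and $\operatorname{Im}F$ are the entrywise real and imaginary parts. The singular space of $q$ is $$S=\Big(\bigcap_{j=0}^{2n-1}\operatorname{Ker}\big[\operatorname{Re}F(\operatorname{Im}F)^j\big]\Big)\cap\mathbb{R}^{2n}.$$ The notation $\oplus^{\sigma\perp}$ means a direct sum of subspaces that are orthogonal to each other with respect to $\sigma$. The case $r=0$ (no real eigenvalues, empty sum equal to $\{0\}$) is allowed. *)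

theory Defs
  imports "HOL-Analysis.Analysis"
begin

text \<open>
  The phase space \<open>\<real>\<^sup>n\<^sub>x \<times> \<real>\<^sup>n\<^sub>\<xi>\<close> is \<^typ>\<open>real ^ ('n + 'n)\<close>: a point \<open>X = (x, \<xi>)\<close> has
  \<open>x\<^sub>i = X $ Inl i\<close> and \<open>\<xi>\<^sub>i = X $ Inr i\<close>, with \<open>n = CARD('n)\<close>.
\<close>

text \<open>
  \<open>\<sigma>((x,\<xi>),(y,\<eta>)) = \<xi> \<cdot> y - x \<cdot> \<eta>\<close>. Over the complex numbers this is the complex-bilinear
  extension, so it cannot be written with the inner product of \<^typ>\<open>complex ^ 'n\<close>.
\<close>
definition sympl_form :: "'a::comm_ring_1 ^ ('n::finite + 'n) \<Rightarrow> 'a ^ ('n + 'n) \<Rightarrow> 'a" where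
  "sympl_form X Y = (\<Sum>i\<in>UNIV. X $ Inr i * Y $ Inl i) - (\<Sum>i\<in>UNIV. X $ Inl i * Y $ Inr i)"

definition cvec :: "real ^ 'm \<Rightarrow> complex ^ 'm" where
  "cvec X = (\<chi> i. complex_of_real (X $ i))"

definition polar :: "(real ^ 'm \<Rightarrow> complex) \<Rightarrow> real ^ 'm \<Rightarrow> real ^ 'm \<Rightarrow> complex" where
  "polar q X Y = (q (X + Y) - q X - q Y) / 2"

definition quadratic_form :: "(real ^ 'm \<Rightarrow> complex) \<Rightarrow> bool" where
  "quadratic_form q \<longleftrightarrow> bilinear (polar q) \<and> (\<forall>X. q X = polar q X X)"

definition is_hamilton_map ::
  "(real ^ ('n::finite + 'n) \<Rightarrow> complex) \<Rightarrow> complex ^ ('n + 'n) ^ ('n + 'n) \<Rightarrow> bool" where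
  "is_hamilton_map q F \<longleftrightarrow> (\<forall>X Y. polar q X Y = sympl_form (cvec X) (F *v cvec Y))"

definition hamilton_map ::
  "(real ^ ('n::finite + 'n) \<Rightarrow> complex) \<Rightarrow> complex ^ ('n + 'n) ^ ('n + 'n)" where
  "hamilton_map q = (THE F. is_hamilton_map q F)"

definition ker :: "'a::comm_ring_1 ^ 'm ^ 'm \<Rightarrow> ('a ^ 'm) set" where
  "ker A = {v. A *v v = 0}"

definition eigenvalues :: "complex ^ 'm ^ 'm \<Rightarrow> complex set" where
  "eigenvalues A = {c. \<exists>v. v \<noteq> 0 \<and> A *v v = c *s v}"

text \<open>The type class power \<open>A ^ j\<close> on matrices is the entrywise one.\<close>
definition matpow :: "'a::semiring_1 ^ 'm ^ 'm \<Rightarrow> nat \<Rightarrow> 'a ^ 'm ^ 'm" where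
  "matpow A j = ((\<lambda>B. A ** B) ^^ j) (mat 1)"

text \<open>
  The matrices \<open>Re F (Im F)\<^sup>j\<close> are real, so the real points of their complex kernels are their
  kernels in the real phase space.
\<close>
definition singular_space :: "(real ^ ('n::finite + 'n) \<Rightarrow> complex) \<Rightarrow> (real ^ ('n + 'n)) set" where
  "singular_space q =
     (\<Inter>j \<in> {0..2 * CARD('n) - 1}.
        ker (map_matrix Re (hamilton_map q) ** matpow (map_matrix Im (hamilton_map q)) j))"

text \<open>
  The plus sign is the elementwise sum of sets; for \<open>l \<noteq> 0\<close> the sum is direct, see
  \<open>ker_inter_ker_neg\<close> below.
\<close>
definition eigenpair_space :: "complex ^ 'm ^ 'm \<Rightarrow> real \<Rightarrow> (real ^ 'm) set" where
  "eigenpair_space F l =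
     {X. cvec X \<in> ker (F - mat (complex_of_real l)) + ker (F + mat (complex_of_real l))}"

definition symplectic_subspace :: "(real ^ ('n::finite + 'n)) set \<Rightarrow> bool" where
  "symplectic_subspace V \<longleftrightarrow>
     subspace V \<and> (\<forall>X\<in>V. (\<forall>Y\<in>V. sympl_form X Y = 0) \<longrightarrow> X = 0)"

text \<open>
  Internal direct sum of pairwise \<open>\<sigma>\<close>-orthogonal subspaces; \<^term>\<open>sum V I\<close> is the elementwise sum
  of sets, which is \<^term>\<open>{0}\<close> for empty \<^term>\<open>I\<close>.
\<close>
definition symp_orth_direct_sum ::
  "(real ^ ('n::finite + 'n)) set \<Rightarrow> 'i set \<Rightarrow> ('i \<Rightarrow> (real ^ ('n + 'n)) set) \<Rightarrow> bool" where
  "symp_orth_direct_sum S I V \<longleftrightarrow>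
     (\<forall>j\<in>I. subspace (V j)) \<and>
     S = sum V I \<and>
     (\<forall>v. (\<forall>j\<in>I. v j \<in> V j) \<and> (\<Sum>j\<in>I. v j) = 0 \<longrightarrow> (\<forall>j\<in>I. v j = 0)) \<and>
     (\<forall>j\<in>I. \<forall>k\<in>I. j \<noteq> k \<longrightarrow> (\<forall>X\<in>V j. \<forall>Y\<in>V k. sympl_form X Y = 0))"

lemma ker_inter_ker_neg:
  assumes "l \<noteq> 0"
  shows "ker (F - mat (complex_of_real l)) \<inter> ker (F + mat (complex_of_real l)) = {0}"
proof -
  have mat_v: "mat c *v v = c *s v" for c :: complex and v :: "complex ^ 'm"
    by (simp add: vec_eq_iff matrix_vector_mult_def mat_def if_distrib if_distribR cong: if_cong)
  have "v = 0" if "F *v v - complex_of_real l *s v = 0" "F *v v + complex_of_real l *s v = 0" for v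
  proof -
    have "complex_of_real l * v $ i = 0" for i
    proof -
      have a: "(F *v v) $ i - complex_of_real l * v $ i = 0"
        using arg_cong[OF that(1), of "\<lambda>w. w $ i"] by simp
      have b: "(F *v v) $ i + complex_of_real l * v $ i = 0"
        using arg_cong[OF that(2), of "\<lambda>w. w $ i"] by simp
      from a b show ?thesis by algebra
    qed
    with assms show ?thesis by (simp add: vec_eq_iff)
  qed
  then show ?thesis
    by (auto simp: ker_def matrix_vector_mult_diff_rdistrib matrix_vector_mult_add_rdistrib mat_v)
qed

lemma cvec_axis: "cvec (axis i 1) = axis i 1"
  by (simp add: cvec_def axis_def vec_eq_iff)

lemma sympl_form_axis_Inl: "sympl_form (axis (Inl i) 1) Y = - (Y $ Inr i)"
  by (simp add: sympl_form_def axis_def if_distrib if_distribR cong: if_cong)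

lemma sympl_form_axis_Inr: "sympl_form (axis (Inr i) 1) Y = Y $ Inl i"
  by (simp add: sympl_form_def axis_def if_distrib if_distribR cong: if_cong)

lemma mult_axis: "((A :: complex ^ 'm ^ 'm) *v axis k 1) $ i = A $ i $ k"
  by (simp add: matrix_vector_mult_def axis_def if_distrib cong: if_cong)

lemma hamilton_map_entries:
  assumes "is_hamilton_map q F"
  shows "F $ Inl i $ k = polar q (axis (Inr i) 1) (axis k 1)"
    and "F $ Inr i $ k = - polar q (axis (Inl i) 1) (axis k 1)"
  using assms
  by (simp_all add: is_hamilton_map_def cvec_axis sympl_form_axis_Inl sympl_form_axis_Inr mult_axis)

lemma polar_expand:
  fixes X Y :: "real ^ 'm"
  assumes "bilinear (polar q)"
  shows "polar q X Y =
    (\<Sum>i\<in>UNIV. \<Sum>k\<in>UNIV. of_real (X $ i) * of_real (Y $ k) * polar q (axis i 1) (axis k 1))"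
proof -
  have l: "linear (\<lambda>X. polar q X Y)" and r: "linear (polar q X)" for X Y
    using assms by (auto simp: bilinear_def)
  have "polar q X Y = polar q (\<Sum>i\<in>UNIV. X $ i *\<^sub>R axis i 1) Y"
    using basis_expansion[of X] by (simp add: scalar_mult_eq_scaleR)
  also have "\<dots> = (\<Sum>i\<in>UNIV. X $ i *\<^sub>R polar q (axis i 1) Y)"
    by (simp add: linear_sum[OF l] linear_cmul[OF l])
  also have "\<dots> = (\<Sum>i\<in>UNIV. X $ i *\<^sub>R polar q (axis i 1) (\<Sum>k\<in>UNIV. Y $ k *\<^sub>R axis k 1))"
    using basis_expansion[of Y] by (simp add: scalar_mult_eq_scaleR)
  also have "\<dots> = (\<Sum>i\<in>UNIV. X $ i *\<^sub>R (\<Sum>k\<in>UNIV. Y $ k *\<^sub>R polar q (axis i 1) (axis k 1)))"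
    by (simp add: linear_sum[OF r] linear_cmul[OF r])
  finally show ?thesis
    by (simp add: scaleR_conv_of_real sum_distrib_left mult.assoc)
qed

lemma ex1_hamilton_map:
  fixes q :: "real ^ ('n::finite + 'n) \<Rightarrow> complex"
  assumes "quadratic_form q"
  shows "\<exists>!F. is_hamilton_map q F"
proof (rule ex_ex1I)
  let ?a = "\<lambda>i k. polar q (axis i 1) (axis k 1)"
  let ?F = "(\<chi> i k. case i of Inl m \<Rightarrow> ?a (Inr m) k | Inr m \<Rightarrow> - ?a (Inl m) k)
    :: complex ^ ('n + 'n) ^ ('n + 'n)"
  have UNIV_sum: "sum f UNIV = (\<Sum>i\<in>UNIV. f (Inl i)) + (\<Sum>i\<in>UNIV. f (Inr i))"
    for f :: "'n + 'n \<Rightarrow> complex"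
    by (subst UNIV_Plus_UNIV[symmetric], subst sum.Plus) (auto simp: sum.reindex)
  have bil: "bilinear (polar q)" using assms by (simp add: quadratic_form_def)
  have "polar q X Y = sympl_form (cvec X) (?F *v cvec Y)" for X Y
    by (subst polar_expand[OF bil])
      (simp add: UNIV_sum sum.distrib distrib_left right_diff_distrib sum_subtractf
        sympl_form_def cvec_def matrix_vector_mult_def sum_distrib_left sum_negf mult_ac)
  then show "\<exists>F. is_hamilton_map q F" by (auto simp: is_hamilton_map_def)
next
  fix F G assume "is_hamilton_map q F" "is_hamilton_map q G"
  then have "F $ i $ k = G $ i $ k" for i k
    by (cases i) (simp_all add: hamilton_map_entries)
  then show "F = G" by (simp add: vec_eq_iff)
qed

end

theory Submission
  imports Defs
begin

text \<open>
  Write \<open>F = A + \<i>B\<close> with \<open>A\<close>, \<open>B\<close> real and skew for \<open>\<sigma>\<close>. The singular space \<open>S\<close> is the largest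
  \<open>B\<close>-invariant subspace of \<open>Ker A\<close>, and on it \<open>q(X) = \<i> \<sigma>(X, B X)\<close>; ellipticity makes the real
  quadratic form \<open>\<sigma>(X, B X)\<close> definite on \<open>S\<close>. For this form \<open>B\<close> is skew-adjoint, hence \<open>B\<^sup>2\<close> is
  diagonalizable on \<open>S\<close> with negative eigenvalues \<open>-\<lambda>\<^sup>2\<close>, and \<open>S\<close> is the sum of the spaces
  \<open>E\<^sub>\<lambda> = {X \<in> S. B\<^sup>2 X = -\<lambda>\<^sup>2 X}\<close>. Conversely, if \<open>F v = \<lambda> v\<close> with \<open>\<lambda>\<close> real and \<open>v = X + \<i>Y\<close>, then
  \<open>\<sigma>(v\<^sup>*, F v)\<close>, where \<open>v\<^sup>*\<close> is the complex conjugate, is purely imaginary, so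
  \<open>Re q(X) + Re q(Y) = 0\<close>; as \<open>Re q \<le> 0\<close>, this forces \<open>A X = A Y = 0\<close>, and then \<open>B X = \<lambda> Y\<close> and
  \<open>B Y = -\<lambda> X\<close> put \<open>X\<close> and \<open>Y\<close> in \<open>E\<^sub>\<lambda>\<close>. So \<open>E\<^sub>\<lambda>\<close> is the real part of
  \<open>Ker (F - \<lambda>) \<oplus> Ker (F + \<lambda>)\<close>.
\<close>

subsection \<open>Definite forms and self-adjoint maps\<close>

text \<open>When \<open>b x x = 0\<close>, the value of the form at \<open>t *\<^sub>R x + y\<close>
  is affine in \<open>t\<close> with slope \<open>2 * b x y\<close>. It can stay nonnegative for all
  \<open>t\<close> only if the slope is zero.\<close>

lemma semidefinite_cauchy_schwarz_zero:
  fixes b :: "'a::real_vector \<Rightarrow> 'a \<Rightarrow> real"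
  assumes b: "bilinear b" and W: "subspace W"
    and sym: "\<And>x y. x \<in> W \<Longrightarrow> y \<in> W \<Longrightarrow> b x y = b y x"
    and nonneg: "\<And>x. x \<in> W \<Longrightarrow> 0 \<le> b x x"
    and x: "x \<in> W" "b x x = 0" and y: "y \<in> W"
  shows "b x y = 0"
proof (rule ccontr)
  assume nz: "b x y \<noteq> 0"
  \<comment> \<open>This \<open>t\<close> makes the affine function equal to -1.\<close>
  define t where "t = - (b y y + 1) / (2 * b x y)"
  have "0 \<le> b (t *\<^sub>R x + y) (t *\<^sub>R x + y)"
    using W x y by (intro nonneg) (simp add: subspace_add subspace_scale)
  also have "\<dots> = 2 * t * b x y + b y y"
    using sym[OF x(1) y] x(2)
    by (simp add: bilinear_ladd[OF b] bilinear_radd[OF b] bilinear_lmul[OF b] bilinear_rmul[OF b])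
  also have "\<dots> = -1"
    using nz by (simp add: t_def field_simps)
  finally show False by simp
qed

text \<open>A maximizer of the Rayleigh quotient of \<open>T\<close> with respect to
  \<open>b\<close> is an eigenvector. The maximum is taken over the Euclidean unit sphere of
  \<open>W\<close>, which is compact; the quotient is invariant under scaling, so this loses
  nothing.\<close>

lemma rayleigh_eigenvector:
  fixes b :: "'a::euclidean_space \<Rightarrow> 'a \<Rightarrow> real" and T :: "'a \<Rightarrow> 'a"
  assumes b: "bilinear b" and T: "linear T" and W: "subspace W" "W \<noteq> {0}"
    and sym: "\<And>x y. x \<in> W \<Longrightarrow> y \<in> W \<Longrightarrow> b x y = b y x"
    and pos: "\<And>x. x \<in> W \<Longrightarrow> x \<noteq> 0 \<Longrightarrow> 0 < b x x"
    and TW: "\<And>x. x \<in> W \<Longrightarrow> T x \<in> W"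
    and adj: "\<And>x y. x \<in> W \<Longrightarrow> y \<in> W \<Longrightarrow> b (T x) y = b x (T y)"
  shows "\<exists>x c. x \<in> W \<and> x \<noteq> 0 \<and> T x = c *\<^sub>R x"
proof -
  let ?K = "W \<inter> sphere 0 1"
  define R where "R x = b x (T x) / b x x" for x
  have cont: "continuous_on ?K (\<lambda>x. b x (h x))" if "linear h" for h
    using bilinear_continuous_on_compose[OF continuous_on_id linear_continuous_on b]
      that linear_conv_bounded_linear by blast
  have nz: "b x x \<noteq> 0" if "x \<in> W" "x \<noteq> 0" for x
    using pos[OF that] by simp
  have contR: "continuous_on ?K R"
    unfolding R_def using nz cont[OF T] cont[OF linear_id]
    by (intro continuous_on_divide) (auto, force)
  have comp: "compact ?K"
    using closed_Int_compact[OF closed_subspace[OF W(1)]] by auto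
  obtain w where w: "w \<in> W" "w \<noteq> 0"
    using W subspace_0 by blast
  then have "w /\<^sub>R norm w \<in> ?K"
    using W(1) by (simp add: subspace_scale)
  then obtain x where x: "x \<in> ?K" "\<And>y. y \<in> ?K \<Longrightarrow> R y \<le> R x"
    using continuous_attains_sup[OF comp _ contR] by blast
  then have xW: "x \<in> W" "x \<noteq> 0" by auto
  define m where "m = R x"
  \<comment> \<open>Maximality of \<open>m\<close> makes \<open>?g\<close> nonnegative on
    \<open>W\<close>, with value zero at \<open>x\<close>. Hence \<open>x\<close> is in its radical,
    that is, \<open>m *\<^sub>R x - T x\<close> is \<open>b\<close>-orthogonal to
    \<open>W\<close>.\<close>
  let ?g = "\<lambda>u v. m * b u v - b u (T v)"
  have bg: "bilinear ?g"
    unfolding bilinear_def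
    by (intro conjI allI linearI)
      (simp_all add: bilinear_ladd[OF b] bilinear_radd[OF b] bilinear_lmul[OF b]
        bilinear_rmul[OF b] linear_add[OF T] linear_cmul[OF T] algebra_simps)
  have max: "0 \<le> ?g y y" if "y \<in> W" for y
  proof (cases "y = 0")
    case False
    have "R y = R (y /\<^sub>R norm y)"
      using False nz[OF that False]
      by (simp add: R_def bilinear_lmul[OF b] bilinear_rmul[OF b] linear_cmul[OF T])
    also have "\<dots> \<le> m"
      unfolding m_def using False that W(1) by (intro x) (simp add: subspace_scale)
    finally show ?thesis
      using pos[OF that False] by (simp add: R_def field_simps)
  qed (simp add: bilinear_lzero[OF b])
  have z: "?g x x = 0"
    using nz[OF xW] by (simp add: m_def R_def)
  have "?g x y = 0" if "y \<in> W" for y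
    using that xW(1) sym adj TW
    by (intro semidefinite_cauchy_schwarz_zero[OF bg W(1) _ max _ z]) auto
  then have orth: "b (m *\<^sub>R x - T x) y = 0" if "y \<in> W" for y
    using that adj xW(1) by (simp add: bilinear_lsub[OF b] bilinear_lmul[OF b])
  have "m *\<^sub>R x - T x \<in> W"
    using W(1) xW(1) TW by (simp add: subspace_diff subspace_scale)
  then have "T x = m *\<^sub>R x"
    using orth pos by fastforce
  then show ?thesis
    using xW by blast
qed

text \<open>Induction on the dimension: split off one eigenvector and pass to its
  \<open>b\<close>-orthogonal complement, which is again invariant. Recording a finite set
  \<open>C\<close> of eigenvalues later yields the finiteness of \<open>L\<close>.\<close>

lemma selfadjoint_diagonalizable:
  fixes b :: "'a::euclidean_space \<Rightarrow> 'a \<Rightarrow> real" and T :: "'a \<Rightarrow> 'a"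
  assumes b: "bilinear b" and T: "linear T" and W: "subspace W"
    and sym: "\<And>x y. x \<in> W \<Longrightarrow> y \<in> W \<Longrightarrow> b x y = b y x"
    and pos: "\<And>x. x \<in> W \<Longrightarrow> x \<noteq> 0 \<Longrightarrow> 0 < b x x"
    and TW: "\<And>x. x \<in> W \<Longrightarrow> T x \<in> W"
    and adj: "\<And>x y. x \<in> W \<Longrightarrow> y \<in> W \<Longrightarrow> b (T x) y = b x (T y)"
  shows "\<exists>C. finite C \<and> W \<subseteq> span {x \<in> W. \<exists>c\<in>C. T x = c *\<^sub>R x}"
  using W sym pos TW adj
proof (induction "dim W" arbitrary: W rule: less_induct)
  case less
  show ?case
  proof (cases "W = {0}")
    case True
    then show ?thesis using span_zero by (intro exI[of _ "{}"]) auto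
  next
    case False
    have "\<exists>x c. x \<in> W \<and> x \<noteq> 0 \<and> T x = c *\<^sub>R x"
      by (rule rayleigh_eigenvector[OF b T less.prems(1) False]) (fact less.prems)+
    then obtain x m where x: "x \<in> W" "x \<noteq> 0" "T x = m *\<^sub>R x" by blast
    let ?V = "{y \<in> W. b x y = 0}"
    have V: "subspace ?V"
      using less.prems(1)
      by (auto simp: subspace_def bilinear_radd[OF b] bilinear_rmul[OF b] bilinear_rzero[OF b])
    have xV: "x \<notin> ?V"
      using less.prems(3)[OF x(1,2)] by simp
    have "dim ?V \<noteq> dim W"
      using subspace_dim_equal[OF V less.prems(1)] xV x(1) by fastforce
    moreover have "dim ?V \<le> dim W"
      by (rule dim_subset) blast
    ultimately have "dim ?V < dim W" by simp
    moreover have TV: "T y \<in> ?V" if "y \<in> ?V" for y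
    proof -
      have "b x (T y) = b (m *\<^sub>R x) y"
        using less.prems(5)[OF x(1), of y] that x(3) by simp
      then show ?thesis
        using that less.prems(4) by (simp add: bilinear_lmul[OF b])
    qed
    ultimately have "\<exists>C. finite C \<and> ?V \<subseteq> span {x \<in> ?V. \<exists>c\<in>C. T x = c *\<^sub>R x}"
      by (intro less.hyps V) (auto intro: less.prems)
    then obtain C where C: "finite C" "?V \<subseteq> span {x \<in> ?V. \<exists>c\<in>C. T x = c *\<^sub>R x}"
      by blast
    let ?E = "{x \<in> W. \<exists>c\<in>insert m C. T x = c *\<^sub>R x}"
    have VE: "?V \<subseteq> span ?E"
      using C(2) span_mono[of "{x \<in> ?V. \<exists>c\<in>C. T x = c *\<^sub>R x}" ?E] by blast
    have "W \<subseteq> span ?E"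
    proof
      fix y assume y: "y \<in> W"
      \<comment> \<open>Coefficient of the \<open>b\<close>-orthogonal projection of
        \<open>y\<close> onto \<open>x\<close>.\<close>
      define s where "s = b x y / b x x"
      have "y - s *\<^sub>R x \<in> ?V"
        using y x xV less.prems(1)
        by (simp add: subspace_diff subspace_scale bilinear_rsub[OF b] bilinear_rmul[OF b] s_def)
      moreover have "s *\<^sub>R x \<in> span ?E"
        using x by (intro span_scale span_base) auto
      ultimately show "y \<in> span ?E"
        using VE by (metis (no_types, lifting) diff_add_cancel span_add subsetD)
    qed
    then show ?thesis
      using C(1) by (intro exI[of _ "insert m C"]) simp
  qed
qed

text \<open>If the form took both signs, it would vanish somewhere on the segment between two such
  points. Anisotropy puts that zero at the origin, so the two points would be linearly dependent,
  which their opposite signs exclude.\<close>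

lemma definite_of_anisotropic:
  fixes b :: "'a::real_vector \<Rightarrow> 'a \<Rightarrow> real"
  assumes b: "bilinear b" and W: "subspace W"
    and aniso: "\<And>x. x \<in> W \<Longrightarrow> b x x = 0 \<Longrightarrow> x = 0"
  obtains s :: real where "\<And>x. x \<in> W \<Longrightarrow> x \<noteq> 0 \<Longrightarrow> 0 < s * b x x"
proof -
  have no: False if x: "x \<in> W" "b x x > 0" and y: "y \<in> W" "b y y < 0" for x y
  proof -
    define p where "p t = b ((1 - t) *\<^sub>R x + t *\<^sub>R y) ((1 - t) *\<^sub>R x + t *\<^sub>R y)" for t
    have p: "p t = (1 - t)\<^sup>2 * b x x + (1 - t) * t * (b x y + b y x) + t\<^sup>2 * b y y" for t
      by (simp add: p_def bilinear_ladd[OF b] bilinear_radd[OF b] bilinear_lmul[OF b]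
          bilinear_rmul[OF b] power2_eq_square distrib_left mult_ac)
    have "continuous_on {0..1} p"
      unfolding p by (intro continuous_intros)
    moreover have "p 0 > 0" "p 1 < 0" using x y by (simp_all add: p)
    ultimately obtain t where t: "0 \<le> t" "t \<le> 1" "p t = 0"
      using IVT2'[of p 1 0 0] by auto
    then have "(1 - t) *\<^sub>R x + t *\<^sub>R y = 0"
      using x y W by (intro aniso) (auto simp: p_def subspace_add subspace_scale)
    then have e: "(1 - t) *\<^sub>R x = (- t) *\<^sub>R y" by (simp add: add_eq_0_iff)
    have "(1 - t)\<^sup>2 * b x x = b ((1 - t) *\<^sub>R x) ((1 - t) *\<^sub>R x)"
      by (simp add: bilinear_lmul[OF b] bilinear_rmul[OF b] power2_eq_square)
    also have "\<dots> = t\<^sup>2 * b y y"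
      unfolding e
      by (simp add: bilinear_lmul[OF b] bilinear_rmul[OF b] bilinear_lneg[OF b] bilinear_rneg[OF b]
          power2_eq_square)
    finally have eq: "(1 - t)\<^sup>2 * b x x = t\<^sup>2 * b y y" .
    \<comment> \<open>The two equal quantities have opposite signs, so both vanish, forcing
      \<open>t = 1\<close> and \<open>t = 0\<close> at once.\<close>
    have "t\<^sup>2 * b y y \<le> 0" "0 \<le> (1 - t)\<^sup>2 * b x x"
      using x y by (auto simp: mult_nonneg_nonpos)
    with eq have "(1 - t)\<^sup>2 * b x x = 0" "t\<^sup>2 * b y y = 0" by linarith+
    with x y show False by auto
  qed
  show ?thesis
  proof (cases "\<exists>x\<in>W. b x x > 0")
    case True
    then have "0 < 1 * b x x" if "x \<in> W" "x \<noteq> 0" for x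
      using no aniso that by (metis linorder_neqE_linordered_idom mult_1)
    then show ?thesis using that by blast
  next
    case False
    then have "0 < (-1) * b x x" if "x \<in> W" "x \<noteq> 0" for x
      using aniso that by (metis linorder_neqE_linordered_idom mult_minus1 neg_0_less_iff_less)
    then show ?thesis using that by blast
  qed
qed

text \<open>
  The subspaces \<open>{x. \<forall>j<k. f (g\<^sup>j x) = 0}\<close> decrease with \<open>k\<close>, and once two consecutive ones agree
  they are all equal from there on; this replaces the theorem of Cayley and Hamilton.
\<close>
lemma kernel_chain_stabilizes:
  fixes f :: "'a::euclidean_space \<Rightarrow> 'b::real_vector" and g :: "'a \<Rightarrow> 'a"
  assumes f: "linear f" and g: "linear g"
    and x: "\<And>j. j < DIM('a) \<Longrightarrow> f ((g ^^ j) x) = 0"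
  shows "f ((g ^^ i) x) = 0"
proof -
  define K where "K k = {x. \<forall>j<k. f ((g ^^ j) x) = 0}" for k
  have lin: "linear (\<lambda>x. f ((g ^^ j) x))" for j
  proof (induction j)
    case (Suc j)
    then show ?case using linear_compose[OF g Suc] by (simp add: o_def funpow_swap1)
  qed (simp add: f)
  have sub: "subspace (K k)" for k
    by (auto simp: K_def subspace_def linear_add[OF lin] linear_cmul[OF lin] linear_0[OF lin])
  have Suc_iff: "y \<in> K (Suc k) \<longleftrightarrow> f y = 0 \<and> g y \<in> K k" for y k
    by (auto simp: K_def funpow_swap1 less_Suc_eq_0_disj)
  have anti: "K k \<subseteq> K j" if "j \<le> k" for j k
    using that by (auto simp: K_def)
  have stable: "K (k + j) = K k" if "K (Suc k) = K k" for k j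
  proof (induction j)
    case (Suc j)
    have "K (Suc (k + j)) = K (Suc k)"
      by (rule set_eqI) (simp only: Suc_iff Suc)
    then show ?case using that by simp
  qed simp
  have "\<exists>k\<le>DIM('a). K (Suc k) = K k"
  proof (rule ccontr)
    assume "\<not> ?thesis"
    then have ne: "K (Suc k) \<noteq> K k" if "k \<le> DIM('a)" for k using that by blast
    \<comment> \<open>Each strict inclusion costs at least one dimension, so
      \<open>Suc DIM('a)\<close> of them in a row are impossible.\<close>
    have "k \<le> Suc DIM('a) \<Longrightarrow> dim (K k) + k \<le> DIM('a)" for k
    proof (induction k)
      case 0
      then show ?case by (simp add: dim_subset_UNIV)
    next
      case (Suc k)
      have "dim (K (Suc k)) \<noteq> dim (K k)"
        using subspace_dim_equal[OF sub sub anti, of k "Suc k"] ne Suc.prems by auto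
      moreover have "dim (K (Suc k)) \<le> dim (K k)"
        by (intro dim_subset anti) simp
      ultimately show ?case using Suc by simp
    qed
    from this[of "Suc DIM('a)"] show False by simp
  qed
  then obtain k where k: "k \<le> DIM('a)" "K (Suc k) = K k" by blast
  have "x \<in> K DIM('a)" using x by (simp add: K_def)
  then have "x \<in> K (k + Suc i)"
    using anti[OF k(1)] stable[OF k(2)] by blast
  then show ?thesis by (simp add: K_def)
qed

subsection \<open>The symplectic form and complex vectors\<close>

lemma bilinear_sympl_form:
  "bilinear (sympl_form :: real ^ ('n::finite + 'n) \<Rightarrow> real ^ ('n + 'n) \<Rightarrow> real)"
  unfolding bilinear_def
  by (intro conjI allI linearI)
    (simp_all add: sympl_form_def algebra_simps sum.distrib sum_distrib_left)

lemma sympl_form_commute: "sympl_form X Y = - sympl_form Y X"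
  by (simp add: sympl_form_def mult.commute)

lemma sympl_form_nondegenerate:
  assumes "\<And>X. sympl_form X Y = 0"
  shows "Y = 0"
proof -
  have "Y $ i = 0" for i
    \<comment> \<open>Pairing with a basis vector of one half reads off, up to sign, the matching
      coordinate of the other half. In each case the instance whose projection fits the constructor
      of \<open>i\<close> is the decisive one.\<close>
    using assms[of "axis (Inr (projl i)) 1"] assms[of "axis (Inl (projr i)) 1"]
    by (cases i) (simp_all add: sympl_form_axis_Inl sympl_form_axis_Inr)
  then show ?thesis by (simp add: vec_eq_iff)
qed

lemma mat_mult_vec: "mat c *v v = c *s v" for v :: "'a::comm_ring_1 ^ 'm"
  by (simp add: vec_eq_iff matrix_vector_mult_def mat_def if_distrib if_distribR cong: if_cong)

lemma in_ker_diff_mat: "v \<in> ker (F - mat c) \<longleftrightarrow> F *v v = c *s v"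
  by (simp add: ker_def matrix_vector_mult_diff_rdistrib mat_mult_vec)

lemma in_ker_add_mat: "v \<in> ker (F + mat c) \<longleftrightarrow> F *v v = (- c) *s v"
  by (simp add: ker_def matrix_vector_mult_add_rdistrib mat_mult_vec add_eq_0_iff2
      vector_sneg_minus1 vector_smult_assoc)

lemma matrix_vector_mult_minus: "A *v (- x) = - (A *v x)" for x :: "real ^ 'm"
  by (rule linear_neg[OF matrix_vector_mul_linear])

lemma matpow_mult_vec: "matpow B j *v X = ((*v) B ^^ j) X"
  by (induction j) (simp_all add: matpow_def flip: matrix_vector_mul_assoc)

abbreviation cplx_vec :: "real ^ 'm \<Rightarrow> real ^ 'm \<Rightarrow> complex ^ 'm" where
  "cplx_vec X Y \<equiv> cvec X + \<i> *s cvec Y"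

lemma cplx_vec_exhaust: obtains X Y where "v = cplx_vec X Y"
proof
  show "v = cplx_vec (\<chi> i. Re (v $ i)) (\<chi> i. Im (v $ i))"
    by (simp add: vec_eq_iff cvec_def complex_eq)
qed

lemma cplx_vec_eq_iff: "cplx_vec X Y = cplx_vec X' Y' \<longleftrightarrow> X = X' \<and> Y = Y'"
  by (auto simp: vec_eq_iff cvec_def complex_eq_iff)

lemma mult_cplx_vec:
  "F *v cplx_vec X Y = cplx_vec (map_matrix Re F *v X - map_matrix Im F *v Y)
     (map_matrix Re F *v Y + map_matrix Im F *v X)"
  by (simp add: vec_eq_iff cvec_def matrix_vector_mult_def map_matrix_def complex_eq_iff
      sum.distrib sum_subtractf sum_negf algebra_simps)

lemma of_real_smult_cplx_vec: "of_real l *s cplx_vec X Y = cplx_vec (l *\<^sub>R X) (l *\<^sub>R Y)"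
  by (simp add: vec_eq_iff cvec_def complex_eq_iff)

text \<open>Because \<open>l\<close> is real, the eigenvalue equation separates into its real and
  imaginary parts without mixing \<open>X\<close> and \<open>Y\<close> on the right.\<close>

lemma real_eigenvector_iff:
  "F *v cplx_vec X Y = of_real l *s cplx_vec X Y \<longleftrightarrow>
    map_matrix Re F *v X - map_matrix Im F *v Y = l *\<^sub>R X \<and>
    map_matrix Re F *v Y + map_matrix Im F *v X = l *\<^sub>R Y"
  by (simp only: mult_cplx_vec of_real_smult_cplx_vec cplx_vec_eq_iff)

subsection \<open>Real eigenvalues and the singular space\<close>

text \<open>Everything the spectral argument needs to know about \<open>q\<close>: the real and
  imaginary parts of its polar form are sigma paired with Re F and Im F, and their symmetry is
  skewness of these matrices for sigma. In \<open>S_eq\<close> all powers occur, so that invariance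
  of \<open>S\<close> is a mere index shift.\<close>

locale dissipative_hamilton =
  fixes F :: "complex ^ ('n::finite + 'n) ^ ('n + 'n)" and S :: "(real ^ ('n + 'n)) set"
  assumes A_skew: "sympl_form X (map_matrix Re F *v Y) = sympl_form Y (map_matrix Re F *v X)"
    and B_skew: "sympl_form X (map_matrix Im F *v Y) = sympl_form Y (map_matrix Im F *v X)"
    and nonpos: "sympl_form X (map_matrix Re F *v X) \<le> 0"
    and S_eq: "S = {X. \<forall>j. map_matrix Re F *v ((*v) (map_matrix Im F) ^^ j) X = 0}"
    and elliptic: "X \<in> S \<Longrightarrow> sympl_form X (map_matrix Im F *v X) = 0 \<Longrightarrow> X = 0"
begin

section \<open>Eigenspaces of the squared imaginary part inside the singular space\<close>

abbreviation "A \<equiv> map_matrix Re F"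

abbreviation "B \<equiv> map_matrix Im F"

text \<open>A description of \<open>eigenpair_space F l\<close> by real data, valid for
  \<open>l \<noteq> 0\<close>; see \<open>eigenpair_space_eq_E\<close>.\<close>

definition E :: "real \<Rightarrow> (real ^ ('n + 'n)) set" where
  "E l = {X \<in> S. B *v (B *v X) = (- l\<^sup>2) *\<^sub>R X}"

lemma A_S: "X \<in> S \<Longrightarrow> A *v X = 0"
  by (auto simp: S_eq dest: spec[of _ 0])

lemma B_S: "X \<in> S \<Longrightarrow> B *v X \<in> S"
  by (auto simp: S_eq funpow_swap1 simp flip: funpow.simps(2)[unfolded o_def] dest: spec[of _ "Suc _"])

lemma subspace_S: "subspace S"
proof -
  have lin: "linear (\<lambda>X. ((*v) B ^^ j) X)" for j
    unfolding matpow_mult_vec[symmetric] by simp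
  show ?thesis
    by (auto simp: S_eq subspace_def linear_0[OF lin] linear_add[OF lin] linear_cmul[OF lin]
        matrix_vector_right_distrib matrix_vector_mult_scaleR)
qed

lemma subspace_E: "subspace (E l)"
  using subspace_S
  by (auto simp: E_def subspace_def matrix_vector_right_distrib matrix_vector_mult_scaleR
      scaleR_right_distrib)

lemma B_E: "X \<in> E l \<Longrightarrow> B *v X \<in> E l"
  by (simp add: E_def B_S matrix_vector_mult_scaleR matrix_vector_mult_minus)

lemma E_minus: "E (- l) = E l"
  by (simp add: E_def)

text \<open>\<open>B\<close> is skew for sigma, and the two signs cancel.\<close>

lemma B2_self_adjoint: "sympl_form (B *v (B *v X)) Y = sympl_form X (B *v (B *v Y))"
  using B_skew[of "B *v Y" X] B_skew[of Y "B *v X"]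
    sympl_form_commute[of "B *v (B *v X)" Y] sympl_form_commute[of "B *v X" "B *v Y"]
  by simp

lemma E_orthogonal:
  assumes "X \<in> E l" "Y \<in> E m" "l\<^sup>2 \<noteq> m\<^sup>2"
  shows "sympl_form X Y = 0"
  using B2_self_adjoint[of X Y] assms
  by (simp add: E_def bilinear_lmul[OF bilinear_sympl_form] bilinear_rmul[OF bilinear_sympl_form]
      bilinear_lneg[OF bilinear_sympl_form] bilinear_rneg[OF bilinear_sympl_form])

text \<open>A vector \<open>X\<close> of the radical is in particular orthogonal to
  \<open>B *v X\<close>, which stays in \<open>E l\<close>; ellipticity then gives
  \<open>X = 0\<close>.\<close>

lemma symplectic_E: "symplectic_subspace (E l)"
  unfolding symplectic_subspace_def
proof (intro conjI ballI impI)
  fix X assume X: "X \<in> E l" and orth: "\<forall>Y\<in>E l. sympl_form X Y = 0"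
  then have "sympl_form X (B *v X) = 0" using B_E by blast
  then show "X = 0" using X elliptic by (auto simp: E_def)
qed (rule subspace_E)

text \<open>A zero of a semidefinite form lies in its radical, and nondegeneracy of sigma identifies
  this radical with the kernel of \<open>A\<close>.\<close>

lemma A_zero_if_form_zero:
  assumes "sympl_form X (A *v X) = 0"
  shows "A *v X = 0"
proof (rule sympl_form_nondegenerate)
  fix Y
  let ?b = "\<lambda>X Y. - sympl_form X (A *v Y)"
  note b = bilinear_sympl_form
  have "bilinear ?b"
    unfolding bilinear_def
    by (intro conjI allI linearI)
      (simp_all add: bilinear_ladd[OF b] bilinear_radd[OF b] bilinear_lmul[OF b]
        bilinear_rmul[OF b] matrix_vector_right_distrib matrix_vector_mult_scaleR)
  from semidefinite_cauchy_schwarz_zero[OF this subspace_UNIV, of X Y]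
  show "sympl_form Y (A *v X) = 0"
    using A_skew nonpos assms by auto
qed

text \<open>The case \<open>l = 0\<close> is included; it serves to exclude the eigenvalue zero in
  \<open>real_eigenvalues\<close>.\<close>

lemma real_eigenvector_in_E:
  assumes "F *v cplx_vec X Y = of_real l *s cplx_vec X Y"
  shows "X \<in> E l" "Y \<in> E l" "B *v X = l *\<^sub>R Y" "B *v Y = (- l) *\<^sub>R X"
proof -
  note b = bilinear_sympl_form
  have 1: "A *v X - B *v Y = l *\<^sub>R X" and 2: "A *v Y + B *v X = l *\<^sub>R Y"
    using assms by (simp_all only: real_eigenvector_iff)
  have self: "sympl_form Z Z = 0" for Z :: "real ^ ('n + 'n)"
    using sympl_form_commute[of Z Z] by simp
  have "sympl_form X (A *v X) - sympl_form X (B *v Y) = 0"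
    using arg_cong[OF 1, of "sympl_form X"]
    by (simp add: bilinear_rsub[OF b] bilinear_rmul[OF b] self)
  moreover have "sympl_form Y (A *v Y) + sympl_form Y (B *v X) = 0"
    using arg_cong[OF 2, of "sympl_form Y"]
    by (simp add: bilinear_radd[OF b] bilinear_rmul[OF b] self)
  \<comment> \<open>Adding the two equations cancels the \<open>B\<close> terms by
    \<open>B_skew\<close>, leaving two nonpositive numbers with sum zero.\<close>
  ultimately have "sympl_form X (A *v X) = 0" "sympl_form Y (A *v Y) = 0"
    using B_skew[of X Y] nonpos[of X] nonpos[of Y] by linarith+
  then have A0: "A *v X = 0" "A *v Y = 0"
    by (blast intro: A_zero_if_form_zero)+
  show BX: "B *v X = l *\<^sub>R Y" and BY: "B *v Y = (- l) *\<^sub>R X"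
    using 1 2 A0 by (simp_all add: minus_equation_iff[of "B *v Y"])
  \<comment> \<open>The span of \<open>X\<close> and \<open>Y\<close> is \<open>B\<close>-invariant
    and contained in the kernel of \<open>A\<close>, hence contained in \<open>S\<close>.\<close>
  have "\<exists>s t. ((*v) B ^^ j) (a *\<^sub>R X + c *\<^sub>R Y) = s *\<^sub>R X + t *\<^sub>R Y" for j a c
  proof (induction j)
    case (Suc j)
    then obtain s t where "((*v) B ^^ j) (a *\<^sub>R X + c *\<^sub>R Y) = s *\<^sub>R X + t *\<^sub>R Y" by blast
    then have "((*v) B ^^ Suc j) (a *\<^sub>R X + c *\<^sub>R Y) = (- t * l) *\<^sub>R X + (s * l) *\<^sub>R Y"
      by (simp add: matrix_vector_right_distrib matrix_vector_mult_scaleR BX BY)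
    then show ?case by blast
  qed auto
  moreover have "A *v (s *\<^sub>R X + t *\<^sub>R Y) = 0" for s t
    by (simp add: A0 matrix_vector_right_distrib matrix_vector_mult_scaleR)
  ultimately have "A *v ((*v) B ^^ j) (a *\<^sub>R X + c *\<^sub>R Y) = 0" for j a c
    by metis
  then have "a *\<^sub>R X + c *\<^sub>R Y \<in> S" for a c
    by (simp add: S_eq)
  from this[of 1 0] this[of 0 1] have "X \<in> S" "Y \<in> S" by simp_all
  then show "X \<in> E l" "Y \<in> E l"
    by (simp_all add: E_def BX BY matrix_vector_mult_scaleR power2_eq_square
        flip: scaleR_minus_left)
qed

text \<open>On \<open>S\<close> the matrix \<open>F\<close> acts as \<open>\<i>\<close> times
  \<open>B\<close>, and the equation \<open>B *v X = l *\<^sub>R Y\<close> dictates the imaginary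
  part \<open>Y\<close>.\<close>

lemma eigenvector_of_E:
  assumes X: "X \<in> E l" and l: "l \<noteq> 0"
  shows "F *v cplx_vec X ((1 / l) *\<^sub>R (B *v X)) = of_real l *s cplx_vec X ((1 / l) *\<^sub>R (B *v X))"
  using assms A_S[of X] A_S[OF B_S[of X]]
  unfolding real_eigenvector_iff
  by (simp add: E_def matrix_vector_mult_scaleR power2_eq_square)

lemma eigenpair_space_eq_E:
  assumes l: "l \<noteq> 0"
  shows "eigenpair_space F l = E l"
proof
  show "eigenpair_space F l \<subseteq> E l"
  proof
    fix X assume "X \<in> eigenpair_space F l"
    then obtain u w where uw: "cvec X = u + w" "F *v u = of_real l *s u"
      "F *v w = of_real (- l) *s w"
      by (auto simp: eigenpair_space_def set_plus_def in_ker_diff_mat in_ker_add_mat)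
    obtain X1 Y1 where u: "u = cplx_vec X1 Y1" by (rule cplx_vec_exhaust)
    obtain X2 Y2 where w: "w = cplx_vec X2 Y2" by (rule cplx_vec_exhaust)
    have "X1 \<in> E l" "X2 \<in> E l"
      using real_eigenvector_in_E(1) uw(2,3) E_minus[of l] u w by blast+
    moreover have "X = X1 + X2"
      using uw(1) by (simp add: u w vec_eq_iff cvec_def complex_eq_iff)
    ultimately show "X \<in> E l"
      using subspace_add[OF subspace_E] by simp
  qed
next
  show "E l \<subseteq> eigenpair_space F l"
  proof
    fix X assume X: "X \<in> E l"
    \<comment> \<open>Half of \<open>X\<close> goes to each eigenvalue; the imaginary parts of
      \<open>?u l\<close> and \<open>?u (- l)\<close> are opposite and cancel in the sum.\<close>
    let ?X = "(1 / 2) *\<^sub>R X"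
    let ?u = "\<lambda>l. cplx_vec ?X ((1 / l) *\<^sub>R (B *v ?X))"
    have hX: "?X \<in> E l" "?X \<in> E (- l)"
      using X subspace_scale[OF subspace_E] by (auto simp: E_minus)
    have "F *v ?u l = of_real l *s ?u l" "F *v ?u (- l) = of_real (- l) *s ?u (- l)"
      using eigenvector_of_E[OF hX(1)] eigenvector_of_E[OF hX(2)] l by (metis neg_equal_0_iff_equal)+
    moreover have "cvec X = ?u l + ?u (- l)"
      by (simp add: vec_eq_iff cvec_def)
    ultimately show "X \<in> eigenpair_space F l"
      unfolding eigenpair_space_def mem_Collect_eq
      by (intro set_plus_intro[of "?u l" _ "?u (- l)", THEN subst[where P = "\<lambda>x. x \<in> _", rotated]])
        (simp_all only: in_ker_diff_mat in_ker_add_mat of_real_minus)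
  qed
qed

text \<open>One positive representative of each pair of opposite eigenvalues, so that distinct
  members also have distinct squares.\<close>

definition L :: "real set" where
  "L = {l. 0 < l \<and> E l \<noteq> {0}}"

lemma L_witness:
  assumes "l \<in> L"
  obtains X where "X \<in> E l" "X \<noteq> 0"
  using assms subspace_0[OF subspace_E[of l]] by (auto simp: L_def)

lemma real_eigenvalues: "eigenvalues F \<inter> \<real> = of_real ` L \<union> (\<lambda>l. - of_real l) ` L"
proof (intro equalityI subsetI)
  fix c assume "c \<in> eigenvalues F \<inter> \<real>"
  then obtain v l where v: "v \<noteq> 0" "F *v v = c *s v" "c = of_real l"
    by (auto simp: eigenvalues_def Reals_def)
  obtain X Y where XY: "v = cplx_vec X Y" by (rule cplx_vec_exhaust)
  have ev: "F *v cplx_vec X Y = of_real l *s cplx_vec X Y"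
    using v XY by simp
  have ne: "X \<noteq> 0 \<or> Y \<noteq> 0"
    using v(1) by (auto simp: XY vec_eq_iff cvec_def)
  have XYE: "X \<in> E l" "Y \<in> E l" and BXY: "B *v X = l *\<^sub>R Y" "B *v Y = (- l) *\<^sub>R X"
    using real_eigenvector_in_E[OF ev] by blast+
  \<comment> \<open>For \<open>l = 0\<close> both \<open>B *v X\<close> and \<open>B *v Y\<close>
    would vanish, and ellipticity would force \<open>X = Y = 0\<close>.\<close>
  have "l \<noteq> 0"
    using ne elliptic[of X] elliptic[of Y] XYE BXY
    by (auto simp: E_def bilinear_rzero[OF bilinear_sympl_form])
  moreover have "E \<bar>l\<bar> = E l" by (simp add: E_def)
  ultimately have "\<bar>l\<bar> \<in> L"
    using XYE ne by (auto simp: L_def)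
  then show "c \<in> of_real ` L \<union> (\<lambda>l. - of_real l) ` L"
    using v(3) by (cases "l \<ge> 0") (auto intro: rev_image_eqI)
next
  fix c :: complex assume "c \<in> of_real ` L \<union> (\<lambda>l. - of_real l) ` L"
  then consider l where "l \<in> L" "c = of_real l" | l where "l \<in> L" "c = of_real (- l)"
    by auto
  then obtain l m where l: "l \<in> L" and m: "c = of_real m" "m = l \<or> m = - l"
    by metis
  have "m \<noteq> 0" using l m(2) by (auto simp: L_def)
  obtain X where "X \<in> E l" "X \<noteq> 0" using l by (rule L_witness)
  then have X: "X \<in> E m" "X \<noteq> 0" using m(2) by (auto simp: E_minus)
  have "cplx_vec X Y \<noteq> 0" for Y
    using X(2) by (auto simp: vec_eq_iff cvec_def complex_eq_iff)
  then show "c \<in> eigenvalues F \<inter> \<real>"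
    using eigenvector_of_E[OF X(1) \<open>m \<noteq> 0\<close>] m(1) Reals_of_real[of m]
    unfolding eigenvalues_def by blast
qed

text \<open>With a suitable sign \<open>s\<close>, the form \<open>s * sympl_form X (B *v Y)\<close>
  is an inner product on \<open>S\<close> for which the square of \<open>B\<close> is self-adjoint,
  so diagonalization applies.\<close>

lemma spectral_decomposition:
  "finite L" "S \<subseteq> span (\<Union>l\<in>L. E l)"
proof -
  note sb = bilinear_sympl_form
  have bil: "bilinear (\<lambda>X Y. c * sympl_form X (B *v Y))" for c
    unfolding bilinear_def
    by (intro conjI allI linearI)
      (simp_all add: bilinear_ladd[OF sb] bilinear_radd[OF sb] bilinear_lmul[OF sb]
        bilinear_rmul[OF sb] matrix_vector_right_distrib matrix_vector_mult_scaleR algebra_simps)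
  obtain s where "\<And>X. X \<in> S \<Longrightarrow> X \<noteq> 0 \<Longrightarrow> 0 < s * (1 * sympl_form X (B *v X))"
    using definite_of_anisotropic[OF bil[of 1] subspace_S] elliptic by auto
  then have pos: "\<And>X. X \<in> S \<Longrightarrow> X \<noteq> 0 \<Longrightarrow> 0 < s * sympl_form X (B *v X)"
    by simp
  define b where "b X Y = s * sympl_form X (B *v Y)" for X Y
  let ?T = "\<lambda>X. B *v (B *v X)"
  have b: "bilinear b"
    using bil[of s] by (simp add: b_def[abs_def])
  have T: "linear ?T"
    using linear_compose[of "(*v) B" "(*v) B"] by (simp add: o_def)
  have adj: "b (?T X) Y = b X (?T Y)" for X Y
    by (simp add: b_def B2_self_adjoint)
  have bsym: "b X Y = b Y X" for X Y
    by (simp add: b_def B_skew[of X Y])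
  have bpos: "X \<in> S \<Longrightarrow> X \<noteq> 0 \<Longrightarrow> 0 < b X X" for X
    using pos by (simp add: b_def)
  have "\<exists>C. finite C \<and> S \<subseteq> span {X \<in> S. \<exists>c\<in>C. ?T X = c *\<^sub>R X}"
    by (rule selfadjoint_diagonalizable[OF b T subspace_S]) (rule bsym, erule (1) bpos, intro B_S, assumption, rule adj)
  then obtain C where C: "finite C" "S \<subseteq> span {X \<in> S. \<exists>c\<in>C. ?T X = c *\<^sub>R X}" by blast
  \<comment> \<open>Otherwise an element of \<open>E l\<close> would be \<open>b\<close>-orthogonal
    to all the eigenvectors spanning \<open>S\<close>, hence to itself.\<close>
  have "- l\<^sup>2 \<in> C" if "l \<in> L" for l
  proof (rule ccontr)
    assume nC: "- l\<^sup>2 \<notin> C"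
    obtain X where X: "X \<in> E l" "X \<noteq> 0" using \<open>l \<in> L\<close> by (rule L_witness)
    have XS: "X \<in> S" using X by (simp add: E_def)
    have orth: "b X Y = 0" if "Y \<in> span {X \<in> S. \<exists>c\<in>C. ?T X = c *\<^sub>R X}" for Y
      using that
    proof (induction rule: span_induct)
      case base
      then show ?case
        by (auto simp: subspace_def bilinear_radd[OF b] bilinear_rmul[OF b] bilinear_rzero[OF b])
    next
      case (step Y)
      then obtain c where c: "c \<in> C" "?T Y = c *\<^sub>R Y" by blast
      have "(c + l\<^sup>2) * b X Y = 0"
        using adj[of X Y] X(1) c(2)
        by (simp add: E_def bilinear_lmul[OF b] bilinear_rmul[OF b] bilinear_lneg[OF b]
            distrib_right)
      moreover have "c + l\<^sup>2 \<noteq> 0"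
        using nC c(1) by (auto simp: add_eq_0_iff2)
      ultimately show ?case by simp
    qed
    show False using orth[OF subsetD[OF C(2) XS]] bpos[OF XS X(2)] by simp
  qed
  then have "L \<subseteq> (\<lambda>c. sqrt (- c)) ` C"
    by (force simp: L_def)
  then show "finite L"
    using C(1) finite_surj by blast
  have "X \<in> span (\<Union>l\<in>L. E l)" if X: "X \<in> S" and c: "?T X = c *\<^sub>R X" for X c
  proof (cases "X = 0")
    case False
    have BX: "B *v X \<noteq> 0"
      using elliptic[OF X] False by (auto simp: bilinear_rzero[OF sb])
    \<comment> \<open>For \<open>b\<close> the matrix \<open>B\<close> itself is skew-adjoint, so
      its square has only negative eigenvalues on \<open>S\<close>, and \<open>sqrt (- c)\<close> is
      the matching element of \<open>L\<close>.\<close>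
    have "c * b X X = b (?T X) X"
      by (simp add: c bilinear_lmul[OF b])
    also have "\<dots> = - b (B *v X) (B *v X)"
      using sympl_form_commute[of "?T X" "B *v X"] by (simp add: b_def)
    also have "\<dots> < 0" using bpos[OF B_S[OF X] BX] by simp
    finally have "c < 0" using bpos[OF X False] by (simp add: mult_less_0_iff)
    then have "X \<in> E (sqrt (- c))" "sqrt (- c) > 0"
      using X c by (simp_all add: E_def)
    moreover from this have "sqrt (- c) \<in> L" using False by (auto simp: L_def)
    ultimately show ?thesis by (blast intro: span_base)
  qed (simp add: span_zero)
  then have "span {X \<in> S. \<exists>c\<in>C. ?T X = c *\<^sub>R X} \<subseteq> span (\<Union>l\<in>L. E l)"
    by (intro span_minimal) auto
  then show "S \<subseteq> span (\<Union>l\<in>L. E l)" using C(2) by blast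
qed

lemma symp_orth_direct_sum_E:
  assumes I: "finite I" and l: "bij_betw l I L"
  shows "symp_orth_direct_sum S I (\<lambda>j. E (l j))"
proof -
  have lpos: "0 < l j" if "j \<in> I" for j
    using l that by (auto simp: bij_betw_def L_def)
  have orth: "sympl_form X Y = 0" if "j \<in> I" "k \<in> I" "j \<noteq> k" "X \<in> E (l j)" "Y \<in> E (l k)" for j k X Y
  proof (rule E_orthogonal[OF that(4,5)])
    \<comment> \<open>Both numbers are positive, so being distinct they have distinct squares, as
      \<open>E_orthogonal\<close> requires.\<close>
    have "l j \<noteq> l k" using l that(1-3) by (auto simp: bij_betw_def inj_on_def)
    then show "(l j)\<^sup>2 \<noteq> (l k)\<^sup>2"
      using lpos[OF that(1)] lpos[OF that(2)] by (simp add: power2_eq_iff)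
  qed
  have sum_eq: "sum (\<lambda>j. E (l j)) I = {sum v I |v. \<forall>j\<in>I. v j \<in> E (l j)}"
    using I by (rule set_sum_alt)
  have sub: "subspace (sum (\<lambda>j. E (l j)) I)"
    unfolding sum_eq
  proof (rule subspaceI)
    show "0 \<in> {sum v I |v. \<forall>j\<in>I. v j \<in> E (l j)}"
      using subspace_0[OF subspace_E] by (auto intro!: exI[of _ "\<lambda>_. 0"])
  next
    fix x y assume "x \<in> {sum v I |v. \<forall>j\<in>I. v j \<in> E (l j)}" "y \<in> {sum v I |v. \<forall>j\<in>I. v j \<in> E (l j)}"
    then obtain v w where "x = sum v I" "y = sum w I" "\<forall>j\<in>I. v j \<in> E (l j)" "\<forall>j\<in>I. w j \<in> E (l j)"
      by blast
    then show "x + y \<in> {sum v I |v. \<forall>j\<in>I. v j \<in> E (l j)}"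
      using subspace_add[OF subspace_E]
      by (auto simp: sum.distrib intro!: exI[of _ "\<lambda>j. v j + w j"])
  next
    fix c x assume "x \<in> {sum v I |v. \<forall>j\<in>I. v j \<in> E (l j)}"
    then obtain v where "x = sum v I" "\<forall>j\<in>I. v j \<in> E (l j)" by blast
    then show "c *\<^sub>R x \<in> {sum v I |v. \<forall>j\<in>I. v j \<in> E (l j)}"
      using subspace_scale[OF subspace_E]
      by (auto simp: scaleR_sum_right intro!: exI[of _ "\<lambda>j. c *\<^sub>R v j"])
  qed
  have "S = sum (\<lambda>j. E (l j)) I"
  proof
    have "X \<in> sum (\<lambda>j. E (l j)) I" if k: "k \<in> I" and X: "X \<in> E (l k)" for X k
    proof -
      have "X = (\<Sum>j\<in>I. if j = k then X else 0)" using I k by simp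
      moreover have "\<forall>j\<in>I. (if j = k then X else 0) \<in> E (l j)"
        using X subspace_0[OF subspace_E] by auto
      ultimately show ?thesis unfolding sum_eq by blast
    qed
    then have "E (l k) \<subseteq> sum (\<lambda>j. E (l j)) I" if "k \<in> I" for k
      using that by auto
    moreover have "L = l ` I" using l by (simp add: bij_betw_def)
    ultimately have "(\<Union>l\<in>L. E l) \<subseteq> sum (\<lambda>j. E (l j)) I"
      by (simp add: UN_subset_iff)
    then have "span (\<Union>l\<in>L. E l) \<subseteq> sum (\<lambda>j. E (l j)) I"
      using sub by (rule span_minimal)
    then show "S \<subseteq> sum (\<lambda>j. E (l j)) I"
      using spectral_decomposition(2) by blast
    show "sum (\<lambda>j. E (l j)) I \<subseteq> S"
      unfolding sum_eq by (auto simp: E_def intro!: subspace_sum[OF subspace_S])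
  qed
  moreover have "v k = 0"
    if vk: "(\<forall>j\<in>I. v j \<in> E (l j)) \<and> (\<Sum>j\<in>I. v j) = 0" and k: "k \<in> I" for v k
  proof -
    have v: "\<forall>j\<in>I. v j \<in> E (l j)" "(\<Sum>j\<in>I. v j) = 0" using vk by blast+
    \<comment> \<open>Pairing with \<open>B *v v k\<close>, an element of \<open>E (l k)\<close>,
      kills every summand but the one at \<open>k\<close>; ellipticity then applies to
      \<open>v k\<close>.\<close>
    have "0 = sympl_form (\<Sum>j\<in>I. v j) (B *v v k)"
      by (simp add: v(2) bilinear_lzero[OF bilinear_sympl_form])
    also have "\<dots> = (\<Sum>j\<in>I. sympl_form (v j) (B *v v k))"
      using bilinear_sympl_form[where 'n = 'n]
      by (intro linear_sum[of "\<lambda>x. sympl_form x (B *v v k)"]) (simp add: bilinear_def)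
    also have "\<dots> = (\<Sum>j\<in>I. if j = k then sympl_form (v k) (B *v v k) else 0)"
      using v(1) k orth B_E by (intro sum.cong refl) auto
    also have "\<dots> = sympl_form (v k) (B *v v k)"
      using I k by simp
    finally show ?thesis
      using elliptic[of "v k"] v(1) k by (auto simp: E_def)
  qed
  ultimately show ?thesis
    unfolding symp_orth_direct_sum_def
    by (intro conjI ballI allI impI subspace_E) (assumption | rule orth)+
qed

end

section \<open>From the quadratic form to its Hamilton map\<close>

lemma symp_orth_direct_sum_cong:
  assumes "\<And>j. j \<in> I \<Longrightarrow> V j = W j"
  shows "symp_orth_direct_sum S I V = symp_orth_direct_sum S I W"
proof -
  have "sum V I = sum W I" using assms by (rule sum.cong[OF refl])
  then show ?thesis using assms by (simp add: symp_orth_direct_sum_def)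
qed

lemma dissipative_hamilton_hamilton_map:
  fixes q :: "real ^ ('n::finite + 'n) \<Rightarrow> complex"
  assumes q: "quadratic_form q"
    and nonpos: "\<And>X. Re (q X) \<le> 0"
    and elliptic: "\<And>X. X \<in> singular_space q \<Longrightarrow> q X = 0 \<Longrightarrow> X = 0"
  shows "dissipative_hamilton (hamilton_map q) (singular_space q)"
proof -
  define F where "F = hamilton_map q"
  let ?A = "map_matrix Re F" and ?B = "map_matrix Im F"
  have "is_hamilton_map q F"
    unfolding F_def hamilton_map_def by (rule theI'[OF ex1_hamilton_map[OF q]])
  then have pol: "polar q X Y = sympl_form (cvec X) (F *v cvec Y)" for X Y
    by (simp add: is_hamilton_map_def)
  have re: "Re (polar q X Y) = sympl_form X (?A *v Y)"
    and im: "Im (polar q X Y) = sympl_form X (?B *v Y)" for X Y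
    unfolding pol
    by (simp_all add: sympl_form_def cvec_def matrix_vector_mult_def map_matrix_def)
  have sym: "polar q X Y = polar q Y X" for X Y
    by (simp add: polar_def add.commute)
  have qq: "q X = polar q X X" for X
    using q by (simp add: quadratic_form_def)
  have S: "singular_space q = {X. \<forall>j. ?A *v ((*v) ?B ^^ j) X = 0}"
  proof -
    \<comment> \<open>The exponents in the definition are exactly those below the real dimension,
      the bound in \<open>kernel_chain_stabilizes\<close>. The natural subtraction is faithful
      because \<open>CARD('n)\<close> is positive.\<close>
    have "{0..2 * CARD('n) - 1} = {..<DIM(real ^ ('n + 'n))}"
    proof -
      have "{0..2 * c - 1} = {..<2 * c}" if "0 < c" for c :: nat using that by auto
      from this[of "CARD('n)"] show ?thesis
        by (simp add: UNIV_Plus_UNIV[symmetric] card_Plus mult_2 del: UNIV_Plus_UNIV)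
    qed
    then have "singular_space q = {X. \<forall>j<DIM(real ^ ('n + 'n)). ?A *v ((*v) ?B ^^ j) X = 0}"
      unfolding singular_space_def F_def[symmetric]
      by (auto simp: ker_def matpow_mult_vec simp flip: matrix_vector_mul_assoc)
    then show ?thesis
      using kernel_chain_stabilizes[of "(*v) ?A" "(*v) ?B"] by auto
  qed
  have "X = 0" if X: "X \<in> singular_space q" and z: "sympl_form X (?B *v X) = 0" for X
  proof (rule elliptic[OF X])
    \<comment> \<open>On the singular space the real part of \<open>q\<close> vanishes, so
      ellipticity of \<open>q\<close> becomes a condition on its imaginary part.\<close>
    have "?A *v X = 0" using X unfolding S by (auto dest: spec[of _ 0])
    then have "Re (q X) = 0" using re[of X X] qq[of X] bilinear_rzero[OF bilinear_sympl_form] by simp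
    moreover have "Im (q X) = 0" using im[of X X] qq[of X] z by simp
    ultimately show "q X = 0" by (simp add: complex_eq_iff)
  qed
  then show ?thesis
    unfolding F_def[symmetric] using S
    by unfold_locales (auto simp: sym nonpos simp flip: re im qq)
qed

theorem mainTheorem5:
  fixes q :: "real ^ ('n::finite + 'n) \<Rightarrow> complex"
  assumes "quadratic_form q"
    and "\<And>X. Re (q X) \<le> 0"
    and "\<And>X. X \<in> singular_space q \<Longrightarrow> q X = 0 \<Longrightarrow> X = 0"
  shows "\<exists>(r::nat) (l :: nat \<Rightarrow> real).
    eigenvalues (hamilton_map q) \<inter> \<real> =
      (\<lambda>j. complex_of_real (l j)) ` {1..r} \<union> (\<lambda>j. - complex_of_real (l j)) ` {1..r} \<and>
    (\<forall>j\<in>{1..r}. l j \<noteq> 0) \<and>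
    (\<forall>j\<in>{1..r}. \<forall>k\<in>{1..r}. j \<noteq> k \<longrightarrow> l j \<noteq> l k \<and> l j \<noteq> - l k) \<and>
    (\<forall>j\<in>{1..r}. symplectic_subspace (eigenpair_space (hamilton_map q) (l j))) \<and>
    symp_orth_direct_sum (singular_space q) {1..r}
      (\<lambda>j. eigenpair_space (hamilton_map q) (l j))"
proof -
  let ?F = "hamilton_map q"
  interpret dissipative_hamilton ?F "singular_space q"
    using assms by (rule dissipative_hamilton_hamilton_map)
  \<comment> \<open>The number r is \<open>card L\<close>; an empty \<open>L\<close> gives r =
    0.\<close>
  obtain l where l: "bij_betw l {1..card L} L"
    using ex_bij_betw_nat_finite_1[OF spectral_decomposition(1)] by blast
  then have img: "L = l ` {1..card L}" and inj: "inj_on l {1..card L}"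
    by (auto simp: bij_betw_def)
  have pos: "0 < l j" if "j \<in> {1..card L}" for j
    using that img unfolding L_def by blast
  have E: "eigenpair_space ?F (l j) = E (l j)" if "j \<in> {1..card L}" for j
    using pos[OF that] by (intro eigenpair_space_eq_E) simp
  have "symp_orth_direct_sum (singular_space q) {1..card L} (\<lambda>j. eigenpair_space ?F (l j))
      = symp_orth_direct_sum (singular_space q) {1..card L} (\<lambda>j. E (l j))"
    using E by (rule symp_orth_direct_sum_cong)
  moreover have "eigenvalues ?F \<inter> \<real> =
      (\<lambda>j. complex_of_real (l j)) ` {1..card L} \<union> (\<lambda>j. - complex_of_real (l j)) ` {1..card L}"
    using real_eigenvalues by (subst (asm) (1 2) img) (simp add: image_image)
  moreover have "l j \<noteq> l k \<and> l j \<noteq> - l k"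
    if "j \<in> {1..card L}" "k \<in> {1..card L}" "j \<noteq> k" for j k
    using pos[OF that(1)] pos[OF that(2)] inj_onD[OF inj _ that(1,2)] that(3) by auto
  moreover have "l j \<noteq> 0" if "j \<in> {1..card L}" for j
    using pos[OF that] by simp
  ultimately show ?thesis
    using symp_orth_direct_sum_E[OF _ l] symplectic_E E
    by (intro exI[of _ "card L"] exI[of _ l] conjI ballI impI) (auto simp del: atLeastAtMost_iff)
qed

end
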